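(* Let $(A^\bullet,\mu,d,c)$ be a curved dg-algebra over a field $k$ of characteristic $0$, so that $|d|=1$, $|c|=2$, $d^2=\operatorname{ad}_c:=[c,-]$ and $d(c)=0$. Then, as endomorphisms of $A^\bullet$, $$d^{2m}=(\operatorname{ad}_c)^m,\qquad d^{2m+1}=(\operatorname{ad}_c)^m\circ d\qquad\text{for all integers } m\ge 0.$$ Equivalently, every iterate $d^r$ ($r\ge 0$) factors uniquely as a power of the inner derivation $\operatorname{ad}_c$ followed by at most one copy of $d$.
   Context: A curved dg-algebra $(A^\bullet,\mu,d,c)$ over a field $k$ of characteristic $0$ consists of an associative unital $\mathbb{Z}$-graded $k$-algebra $A^\bullet=\bigoplus_{i\in\mathbb{Z}}A^i$ with product $\mu$ and with every $A^i$ a finite-dimensional $k$-vector space; a $k$-linear map $d:A^\bullet\to A^\bullet$ of degree $1$ satisfying the graded Leibniz rule $d(xy)=d(x)y+(-1)^{|x|}x\,d(y)$ for homogeneous $x$; and an element $c\in A^2$ (the curvature) with $d(c)=0$ and $d^2=\operatorname{ad}_c$. Here $|x|$ is the degree of a homogeneous element $x$, $[x,y]=xy-(-1)^{|x||y|}yx$ is the graded commutator, and $\operatorname{ad}_x=[x,-]$ is the inner derivation given by $x$. Iterates and powers are taken under composition, with $d^0=(\operatorname{ad}_c)^0=\mathrm{id}$.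
   Formalization: "Factors uniquely" fails literally when d^r = 0 (e.g. d = 0, c = 0), so uniqueness of the factorization is stated among those of matching total degree r for every r, and without the degree condition only when d^r is not the zero map. *)

theory Defs
  imports Complex_Main
begin

text \<open>
  The sort \<open>{ring, monoid_mult}\<close> is that of associative unital rings in which \<open>1 = 0\<close> is allowed
  (unlike \<open>ring_1\<close>), so the zero algebra is included.
\<close>

locale unital_algebra = vector_space scale
  for scale :: "'k::field \<Rightarrow> 'a::{ring, monoid_mult} \<Rightarrow> 'a" (infixr \<open>*s\<close> 75) +
  assumes scale_mult_left: "(a *s x) * y = a *s (x * y)"
    and scale_mult_right: "x * (a *s y) = a *s (x * y)"

text \<open>
  The whole type is the direct sum of the subspaces \<open>A i\<close>: every element has exactly one
  finitely supported family of homogeneous components.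
\<close>

definition is_decomposition :: "(int \<Rightarrow> 'a::ab_group_add set) \<Rightarrow> 'a \<Rightarrow> (int \<Rightarrow> 'a) \<Rightarrow> bool" where
  "is_decomposition A x f \<longleftrightarrow>
     (\<forall>i. f i \<in> A i) \<and> finite {i. f i \<noteq> 0} \<and> x = (\<Sum>i | f i \<noteq> 0. f i)"

locale graded_algebra = unital_algebra scale
  for scale :: "'k::field \<Rightarrow> 'a::{ring, monoid_mult} \<Rightarrow> 'a" (infixr \<open>*s\<close> 75) +
  fixes A :: "int \<Rightarrow> 'a set"
  assumes subspace_A: "subspace (A i)"
    and direct_sum: "\<exists>!f. is_decomposition A x f"
    and one_mem: "1 \<in> A 0"
    and mult_mem: "x \<in> A i \<Longrightarrow> y \<in> A j \<Longrightarrow> x * y \<in> A (i + j)"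
begin

definition hcomp :: "'a \<Rightarrow> int \<Rightarrow> 'a" where
  "hcomp x = (THE f. is_decomposition A x f)"

text \<open>
  The graded commutator \<open>[x, y] = x y - (-1)\<^bsup>|x| |y|\<^esup> y x\<close> of homogeneous elements, extended
  biadditively; see \<open>gcommutator_homogeneous\<close> below.
\<close>

definition gcommutator :: "'a \<Rightarrow> 'a \<Rightarrow> 'a" where
  "gcommutator x y =
     (\<Sum>i | hcomp x i \<noteq> 0. \<Sum>j | hcomp y j \<noteq> 0.
        hcomp x i * hcomp y j - ((-1) powi (i * j)) *s (hcomp y j * hcomp x i))"

definition ad :: "'a \<Rightarrow> 'a \<Rightarrow> 'a" where
  "ad x = (\<lambda>y. gcommutator x y)"

lemma hcomp_homogeneous:
  assumes "x \<in> A i"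
  shows "hcomp x = (\<lambda>j. if j = i then x else 0)"
proof -
  let ?f = "\<lambda>j. if j = i then x else 0"
  have supp: "{j. ?f j \<noteq> 0} = (if x = 0 then {} else {i})"
    by auto
  have "is_decomposition A x ?f"
    unfolding is_decomposition_def supp using assms subspace_0[OF subspace_A] by auto
  then show ?thesis
    unfolding hcomp_def using direct_sum by (rule the1_equality[rotated])
qed

lemma gcommutator_homogeneous:
  assumes "x \<in> A i" "y \<in> A j"
  shows "gcommutator x y = x * y - ((-1) powi (i * j)) *s (y * x)"
proof -
  have supp: "{l. (if l = n then z else 0) \<noteq> 0} = (if z = 0 then {} else {n})"
    for n :: int and z :: 'a
    by auto
  show ?thesis
    unfolding gcommutator_def hcomp_homogeneous[OF assms(1)] hcomp_homogeneous[OF assms(2)] supp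
    by simp
qed

end

locale curved_dg_algebra = graded_algebra scale A
  for scale :: "'k::field_char_0 \<Rightarrow> 'a::{ring, monoid_mult} \<Rightarrow> 'a" (infixr \<open>*s\<close> 75)
    and A :: "int \<Rightarrow> 'a set" +
  fixes d :: "'a \<Rightarrow> 'a" and c :: 'a
  assumes finite_dimensional: "\<exists>B. finite B \<and> A i = span B"
    and d_linear: "Vector_Spaces.linear scale scale d"
    and d_mem: "x \<in> A i \<Longrightarrow> d x \<in> A (i + 1)"
    and d_Leibniz: "x \<in> A i \<Longrightarrow> d (x * y) = d x * y + ((-1) powi i) *s (x * d y)"
    and c_mem: "c \<in> A 2"
    and d_c: "d c = 0"
    and d_d: "d \<circ> d = ad c"

end

theory Submission
  imports Defs
begin

text \<open>
  The formulas for \<open>d ^^ r\<close> are \<open>d \<circ> d = ad c\<close> iterated. Uniqueness of the factorisation comes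
  from the grading: \<open>d ^^ r\<close> has degree \<open>r\<close>, so if \<open>d ^^ r = d ^^ s\<close> with \<open>r \<noteq> s\<close>, it sends
  homogeneous elements into \<open>A (i + r) \<inter> A (i + s) = {0}\<close> and hence vanishes.
\<close>

context graded_algebra
begin

text \<open>By \<open>hcomp_homogeneous\<close> the component family of \<open>x\<close> is
  concentrated both in degree \<open>i\<close> and in degree \<open>j\<close>. Zero is excluded
  because it lies in every \<open>A i\<close>.\<close>

lemma homogeneous_degree_unique:
  assumes "x \<in> A i" "x \<in> A j" "x \<noteq> 0"
  shows "i = j"
  using hcomp_homogeneous[OF assms(1)] hcomp_homogeneous[OF assms(2)] assms(3)
  by (metis (no_types))

text \<open>Supplies, for a nonzero linear map, a homogeneous element that it does not kill, on
  which degrees can be compared.\<close>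

lemma linear_eq_0_on_homogeneous:
  assumes lin: "Vector_Spaces.linear scale scale f"
    and hom: "\<And>i x. x \<in> A i \<Longrightarrow> f x = 0"
  shows "f = (\<lambda>x. 0)"
proof
  fix x
  interpret f: Vector_Spaces.linear scale scale f by (fact lin)
  obtain g where g: "is_decomposition A x g"
    using direct_sum by blast
  then have "f x = (\<Sum>i | g i \<noteq> 0. f (g i))"
    unfolding is_decomposition_def using f.sum by metis
  also have "\<dots> = 0"
    using g hom by (intro sum.neutral) (auto simp: is_decomposition_def)
  finally show "f x = 0" .
qed

end

context curved_dg_algebra
begin

lemma linear_funpow_d: "Vector_Spaces.linear scale scale (d ^^ r)"
proof (induction r)
  case 0
  then show ?case using linear_id by (simp add: id_def)
next
  case (Suc r)
  then show ?case
    using Vector_Spaces.linear_compose[OF Suc.IH d_linear] by (simp add: comp_def)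
qed

lemma funpow_d_mem: "x \<in> A i \<Longrightarrow> (d ^^ r) x \<in> A (i + int r)"
proof (induction r)
  case (Suc r)
  then show ?case using d_mem[of "(d ^^ r) x" "i + int r"] by (simp add: add_ac)
qed simp

lemma funpow_d_inject:
  assumes "d ^^ r = d ^^ s" "d ^^ r \<noteq> (\<lambda>x. 0)"
  shows "r = s"
proof -
  obtain i x where "x \<in> A i" "(d ^^ r) x \<noteq> 0"
    using linear_eq_0_on_homogeneous[OF linear_funpow_d] assms(2) by blast
  with funpow_d_mem[of x i r] funpow_d_mem[of x i s] assms(1) show ?thesis
    using homogeneous_degree_unique by fastforce
qed

lemma funpow_d_even: "d ^^ (2 * m) = ad c ^^ m"
proof -
  have "d ^^ 2 = ad c"
    using d_d by (simp add: numeral_2_eq_2)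
  then show ?thesis
    by (metis funpow_mult)
qed

text \<open>Collapses any candidate factorisation to a single iterate of \<open>d\<close>, so that
  comparing factorisations becomes comparing exponents.\<close>

lemma ad_funpow_comp_funpow_d: "(ad c ^^ m) \<circ> (d ^^ e) = d ^^ (2 * m + e)"
  by (simp add: funpow_add funpow_d_even)

end

theorem theorem3:
  fixes scale :: "'k::field_char_0 \<Rightarrow> 'a::{ring, monoid_mult} \<Rightarrow> 'a"
    and A :: "int \<Rightarrow> 'a set"
    and d :: "'a \<Rightarrow> 'a"
    and c :: 'a
  assumes "curved_dg_algebra scale A d c"
  shows "(\<forall>m. d ^^ (2 * m) = graded_algebra.ad scale A c ^^ m)
    \<and> (\<forall>m. d ^^ (2 * m + 1) = (graded_algebra.ad scale A c ^^ m) \<circ> d)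
    \<and> (\<forall>r. \<exists>!(m, e). e \<le> 1 \<and> 2 * m + e = r
           \<and> d ^^ r = (graded_algebra.ad scale A c ^^ m) \<circ> (d ^^ e))
    \<and> (\<forall>r. d ^^ r \<noteq> (\<lambda>x. 0) \<longrightarrow>
           (\<exists>!(m, e). e \<le> 1 \<and> d ^^ r = (graded_algebra.ad scale A c ^^ m) \<circ> (d ^^ e)))"
proof -
  interpret curved_dg_algebra scale A d c by (fact assms)
  \<comment> \<open>Division with remainder by 2: the bound on \<open>e\<close> forces it to be the
    remainder.\<close>
  have digits: "\<exists>!(m, e). e \<le> 1 \<and> 2 * m + e = r" for r :: nat
    by (rule ex1I[of _ "(r div 2, r mod 2)"]) auto
  have factor: "\<exists>!(m, e). e \<le> 1 \<and> 2 * m + e = r \<and> d ^^ r = (ad c ^^ m) \<circ> (d ^^ e)" for r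
  proof -
    \<comment> \<open>The operator equation follows from the exponent equation, so only the latter
      constrains the pair.\<close>
    have "(e \<le> 1 \<and> 2 * m + e = r \<and> d ^^ r = (ad c ^^ m) \<circ> (d ^^ e)) \<longleftrightarrow> e \<le> 1 \<and> 2 * m + e = r"
      for m e
      using ad_funpow_comp_funpow_d[of m e] by auto
    then show ?thesis using digits by simp
  qed
  have factor': "\<exists>!(m, e). e \<le> 1 \<and> d ^^ r = (ad c ^^ m) \<circ> (d ^^ e)" if "d ^^ r \<noteq> (\<lambda>x. 0)" for r
  proof -
    \<comment> \<open>Here the exponent equation has to be recovered from the operator equation,
      which reads \<open>d ^^ r = d ^^ (2 * m + e)\<close>; nonvanishing of \<open>d ^^ r\<close>
      makes this possible.\<close>
    have "(e \<le> 1 \<and> d ^^ r = (ad c ^^ m) \<circ> (d ^^ e)) \<longleftrightarrow> e \<le> 1 \<and> 2 * m + e = r" for m e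
      unfolding ad_funpow_comp_funpow_d using funpow_d_inject[OF _ that] by auto
    then show ?thesis using digits by simp
  qed
  have odd: "d ^^ (2 * m + 1) = (ad c ^^ m) \<circ> d" for m
    using ad_funpow_comp_funpow_d[of m 1] by simp
  show ?thesis
    using funpow_d_even odd factor factor' by blast
qed

end
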